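(* Let $A$ be a finite-dimensional $C^*$-algebra with $\mathbb{C}$-basis $(e_i)_i$, and let the involution $x\mapsto x^*$ of $A$ be written in real coordinates as $$(x^* )^{0j}=\sum_i\left(f^{0j}_{0i}x^{0i}+f^{1j}_{0i}x^{1i}\right),\qquad (x^* )^{1j}=\sum_i\left(f^{1j}_{0i}x^{0i}-f^{0j}_{0i}x^{1i}\right),$$ with real numbers $f^{0j}_{0i},f^{1j}_{0i}$. Then for all $j,k$ $$\delta^j_k=\sum_i\left(f^{0j}_{0i}f^{0i}_{0k}+f^{1j}_{0i}f^{1i}_{0k}\right),\qquad 0=\sum_i\left(f^{0j}_{0i}f^{1i}_{0k}-f^{1j}_{0i}f^{0i}_{0k}\right).$$
   Context: A $C^*$-algebra $A$ is a Banach algebra over $\mathbb{C}$ endowed with an involution, i.e. an additive map $x\mapsto x^*$ of $A$ to itself such that $(cx)^*=\bar c\,x^*$ for $c\in\mathbb{C}$, $(xy)^*=y^*x^*$, $x^{**}=x$ and $\|x^*x\|=\|x\|^2$ for all $x,y\in A$. The real coordinates $x^{0i},x^{1i}\in\mathbb{R}$ of $x\in A$ with respect to the $\mathbb{C}$-basis $(e_i)$ are defined by $x=\sum_i(x^{0i}+x^{1i}\mathrm{i})e_i$, where $\mathrm{i}$ is the imaginary unit. Every antilinear self-map of $A$ can be written in the displayed coordinate form. $\delta^j_k$ is the Kronecker symbol. *)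

theory Defs
  imports "HOL-Analysis.Analysis"
begin

text \<open>
  Complex scalar multiplication is an explicit parameter \<open>scale\<close>. The norm, completeness, the
  (not necessarily unital) ring structure and submultiplicativity of the norm come from the type
  classes, whose real scalar multiplication is required to be the restriction of \<open>scale\<close>.
\<close>

locale complex_banach_algebra = vector_space scale
  for scale :: "complex \<Rightarrow> 'a::{real_normed_algebra, banach} \<Rightarrow> 'a" +
  assumes scale_of_real: "scale (of_real r) x = r *\<^sub>R x"
    and norm_scale: "norm (scale c x) = cmod c * norm x"
    and scale_mult_left: "scale c x * y = scale c (x * y)"
    and scale_mult_right: "x * scale c y = scale c (x * y)"
begin

definition finite_dim :: bool where
  "finite_dim \<longleftrightarrow> (\<exists>B. finite B \<and> span B = UNIV)"

definition basis_family :: "'i set \<Rightarrow> ('i \<Rightarrow> 'a) \<Rightarrow> bool" where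
  "basis_family I e \<longleftrightarrow> inj_on e I \<and> independent (e ` I) \<and> span (e ` I) = UNIV"

text \<open>
  \<open>coord0 I e x i\<close> and \<open>coord1 I e x i\<close> are the real coordinates $x^{0i}$ and $x^{1i}$ of \<open>x\<close>;
  the lemmas \<open>coord_expansion\<close> and \<open>coord_unique\<close> below confirm the defining property
  $x = \sum_i (x^{0i} + x^{1i} \mathrm{i}) e_i$.
\<close>

definition coord0 :: "'i set \<Rightarrow> ('i \<Rightarrow> 'a) \<Rightarrow> 'a \<Rightarrow> 'i \<Rightarrow> real" where
  "coord0 I e x i = Re (representation (e ` I) x (e i))"

definition coord1 :: "'i set \<Rightarrow> ('i \<Rightarrow> 'a) \<Rightarrow> 'a \<Rightarrow> 'i \<Rightarrow> real" where
  "coord1 I e x i = Im (representation (e ` I) x (e i))"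

lemma basis_family_finite:
  assumes "finite_dim" "basis_family I e"
  shows "finite I"
proof -
  obtain B where "finite B" "span B = UNIV"
    using assms(1) by (auto simp: finite_dim_def)
  then have "finite (e ` I)"
    using assms(2) independent_span_bound[of B "e ` I"] by (auto simp: basis_family_def)
  then show ?thesis
    using assms(2) by (auto simp: basis_family_def dest: finite_imageD)
qed

lemma coord_expansion:
  assumes "finite_dim" "basis_family I e"
  shows "x = (\<Sum>i\<in>I. scale (of_real (coord0 I e x i) + of_real (coord1 I e x i) * \<i>) (e i))"
proof -
  have b: "inj_on e I" "independent (e ` I)" "span (e ` I) = UNIV"
    using assms(2) by (auto simp: basis_family_def)
  have "x = (\<Sum>b\<in>e ` I. scale (representation (e ` I) x b) b)"
    using sum_representation_eq[of "e ` I" x "e ` I"] b basis_family_finite[OF assms] by simp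
  also have "\<dots> = (\<Sum>i\<in>I. scale (representation (e ` I) x (e i)) (e i))"
    using b by (simp add: sum.reindex)
  finally show ?thesis
    by (simp add: coord0_def coord1_def complex_eq[symmetric] mult.commute[of _ \<i>])
qed

lemma coord_unique:
  assumes "finite_dim" "basis_family I e"
    and "x = (\<Sum>i\<in>I. scale (of_real (a i) + of_real (b i) * \<i>) (e i))" and "i \<in> I"
  shows "coord0 I e x i = a i" "coord1 I e x i = b i"
proof -
  have inj: "inj_on e I" and ind: "independent (e ` I)" and sp: "span (e ` I) = UNIV"
    using assms(2) by (auto simp: basis_family_def)
  have fin: "finite I" by (rule basis_family_finite[OF assms(1,2)])
  let ?c = "\<lambda>i. of_real (a i) + of_real (b i) * \<i>"
  have "representation (e ` I) x (e i) = (\<Sum>k\<in>I. ?c k * representation (e ` I) (e k) (e i))"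
    using ind sp by (simp add: assms(3) representation_sum representation_scale)
  also have "\<dots> = (\<Sum>k\<in>I. if k = i then ?c k else 0)"
    using ind inj assms(4)
    by (intro sum.cong refl) (auto simp: representation_basis inj_on_eq_iff)
  also have "\<dots> = ?c i" using fin assms(4) by simp
  finally show "coord0 I e x i = a i" "coord1 I e x i = b i"
    by (simp_all add: coord0_def coord1_def)
qed

end

locale c_star_algebra = complex_banach_algebra scale
  for scale :: "complex \<Rightarrow> 'a::{real_normed_algebra, banach} \<Rightarrow> 'a" +
  fixes star :: "'a \<Rightarrow> 'a"
  assumes star_add: "star (x + y) = star x + star y"
    and star_scale: "star (scale c x) = scale (cnj c) (star x)"
    and star_mult: "star (x * y) = star y * star x"
    and star_star: "star (star x) = x"
    and norm_star_mult_self: "norm (star x * x) = (norm x)\<^sup>2"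

end

theory Submission
  imports Defs
begin

text \<open>Comparing the coordinates of $e_k^{**} = e_k$ gives both identities.\<close>

context complex_banach_algebra
begin

text \<open>With F the complex matrix whose entries are \<open>f0 j i + f1 j i * \<i>\<close>, the
  two coordinate formulas say that star sends a coordinate vector x to F conj(x). Involutivity then
  means F conj(F) = 1, and the claims are the real part of this equation and, up to sign, the
  imaginary part. It is read off column by column by evaluating star twice on \<open>e k\<close>,
  whose coordinates \<open>coord_basis\<close> supplies.\<close>

lemma coord_basis:
  assumes "basis_family I e" "i \<in> I" "k \<in> I"
  shows "coord0 I e (e k) i = (if i = k then 1 else 0)" "coord1 I e (e k) i = 0"
  using assms
  by (auto simp: basis_family_def coord0_def coord1_def representation_basis inj_on_eq_iff)

end

theorem theorem12p2:
  fixes scale :: "complex \<Rightarrow> 'a::{real_normed_algebra, banach} \<Rightarrow> 'a"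
    and star :: "'a \<Rightarrow> 'a"
    and I :: "'i set" and e :: "'i \<Rightarrow> 'a"
    and f0 f1 :: "'i \<Rightarrow> 'i \<Rightarrow> real"
  assumes "c_star_algebra scale star"
    and "complex_banach_algebra.finite_dim scale"
    and "complex_banach_algebra.basis_family scale I e"
    and "\<And>x j. j \<in> I \<Longrightarrow>
      complex_banach_algebra.coord0 scale I e (star x) j =
        (\<Sum>i\<in>I. f0 j i * complex_banach_algebra.coord0 scale I e x i
              + f1 j i * complex_banach_algebra.coord1 scale I e x i)"
    and "\<And>x j. j \<in> I \<Longrightarrow>
      complex_banach_algebra.coord1 scale I e (star x) j =
        (\<Sum>i\<in>I. f1 j i * complex_banach_algebra.coord0 scale I e x i
              - f0 j i * complex_banach_algebra.coord1 scale I e x i)"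
  shows "\<forall>j\<in>I. \<forall>k\<in>I.
      (if j = k then 1 else 0) = (\<Sum>i\<in>I. f0 j i * f0 i k + f1 j i * f1 i k) \<and>
      0 = (\<Sum>i\<in>I. f0 j i * f1 i k - f1 j i * f0 i k)"
proof (intro ballI)
  fix j k assume j: "j \<in> I" and k: "k \<in> I"
  interpret c_star_algebra scale star by (rule assms(1))
  note star0 = assms(4) and star1 = assms(5)
  \<comment> \<open>Finiteness lets a sum against a Kronecker delta collapse to its single nonzero
    term.\<close>
  have fin: "finite I" by (rule basis_family_finite[OF assms(2,3)])
  note basis = coord_basis[OF assms(3) _ k]
  \<comment> \<open>The coordinates of \<open>star (e k)\<close> are column k of F.\<close>
  have e0: "coord0 I e (star (e k)) i = f0 i k"
    and e1: "coord1 I e (star (e k)) i = f1 i k" if "i \<in> I" for i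
    using that k fin by (simp_all add: star0 star1 basis if_distrib[of "(*) _"] cong: if_cong)
  \<comment> \<open>The formula is now applied to \<open>star (e k)\<close>; its left side becomes a
    coordinate of \<open>e k\<close> by \<open>star_star\<close>.\<close>
  have "coord0 I e (e k) j = (\<Sum>i\<in>I. f0 j i * f0 i k + f1 j i * f1 i k)"
    using star0[OF j, of "star (e k)"] by (simp add: star_star e0 e1)
  moreover have "coord1 I e (e k) j = (\<Sum>i\<in>I. f1 j i * f0 i k - f0 j i * f1 i k)"
    using star1[OF j, of "star (e k)"] by (simp add: star_star e0 e1)
  ultimately show "(if j = k then 1 else 0) = (\<Sum>i\<in>I. f0 j i * f0 i k + f1 j i * f1 i k) \<and>
      0 = (\<Sum>i\<in>I. f0 j i * f1 i k - f1 j i * f0 i k)"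
    \<comment> \<open>The imaginary part came out with the opposite sign; splitting both differences
      of sums makes the two forms of the equation agree.\<close>
    by (simp add: basis j sum_subtractf)
qed

end
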